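(* Let $\mathcal{A}$ be a unital $C^*$-algebra and let $F\in\mathcal{A}$, regarded also as an operator in $B(\mathcal{A})$. (1) If there is a decomposition $\mathcal{A}=M_1\tilde\oplus N_1\stackrel{F}{\longrightarrow}M_2\tilde\oplus N_2=\mathcal{A}$ with respect to which $F$ has the matrix $\begin{pmatrix}F_1&0\\0&F_4\end{pmatrix}$, where $F_1$ is an isomorphism, then there exist projections $P,Q\in\mathcal{A}$ with $P\sim P_{N_1}$ and $Q\sim P_{N_2}$ such that $F$ is invertible up to the pair $(P,Q)$. (2) Conversely, if $F$ is invertible up to a pair $(P,Q)$ of projections in $\mathcal{A}$, then there is a decomposition $\mathcal{A}=M_1\tilde\oplus N_1\stackrel{F}{\longrightarrow}M_2\tilde\oplus N_2=\mathcal{A}$ with respect to which $F$ has the matrix $\begin{pmatrix}F_1&0\\0&F_4\end{pmatrix}$, where $F_1$ is an isomorphism, and such that $P\sim P_{N_1}$ and $Q\sim P_{N_2}$.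
   Context: $\mathcal{A}$ is regarded as a right Hilbert $C^*$-module over itself with $\langle x,y\rangle=x^*y$. $B(\mathcal{A})$ is the $C^*$-algebra of bounded $\mathcal{A}$-linear operators on $\mathcal{A}$ (all are adjointable); it is identified with $\mathcal{A}$ via $a\mapsto L_a$ (left multiplication). Projections in $\mathcal{A}$ are orthogonal projections ($p=p^*=p^2$). For projections $p,q\in\mathcal{A}$, $p\sim q$ means there is $v\in\mathcal{A}$ with $vv^*=p$, $v^*v=q$ (Murray-von Neumann equivalence). Invertibility up to a pair: for $a\in\mathcal{A}$ and projections $p,q\in\mathcal{A}$, $a$ is invertible up to the pair $(p,q)$ if there is $b\in\mathcal{A}$ with $(1-q)a(1-p)b=1-q$ and $b(1-q)a(1-p)=1-p$. $M\tilde\oplus N=\mathcal{A}$ means $M,N$ are closed submodules with $M\cap N=\{0\}$, $M+N=\mathcal{A}$ (not necessarily orthogonal). A closed submodule $N$ of $\mathcal{A}$ is complementable if $M\tilde\oplus N=\mathcal{A}$ for some closed submodule $M$; every such $N$ is orthogonally complementable in $\mathcal{A}$, and $P_N\in B(\mathcal{A})$ denotes the orthogonal projection onto $N$. An isomorphism of Hilbert modules is a bounded $\mathcal{A}$-linear bijection. That $F$ has the matrix $\begin{pmatrix}F_1&0\\0&F_4\end{pmatrix}$ with respect to $\mathcal{A}=M_1\tilde\oplus N_1\stackrel{F}{\longrightarrow}M_2\tilde\oplus N_2=\mathcal{A}$ means $F(M_1)\subseteq M_2$, $F(N_1)\subseteq N_2$, $F_1=F|_{M_1}:M_1\to M_2$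 and $F_4=F|_{N_1}:N_1\to N_2$. *)

theory Defs
  imports "HOL-Analysis.Analysis"
begin

(* The library has no complex normed spaces, so complex scalar multiplication is a class
   parameter, tied to the real one by scaleR_eq_scaleC.  Taking 1 from monoid_mult instead of
   ring_1 does not force 1 \<noteq> 0, so the zero algebra is included. *)
class unital_cstar_algebra = banach + real_normed_algebra + monoid_mult +
  fixes scaleC :: "complex \<Rightarrow> 'a \<Rightarrow> 'a" (infixr "*\<^sub>C" 75)
    and star :: "'a \<Rightarrow> 'a"
  assumes scaleC_add_right: "c *\<^sub>C (x + y) = c *\<^sub>C x + c *\<^sub>C y"
    and scaleC_add_left: "(c + d) *\<^sub>C x = c *\<^sub>C x + d *\<^sub>C x"
    and scaleC_scaleC: "c *\<^sub>C d *\<^sub>C x = (c * d) *\<^sub>C x"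
    and scaleR_eq_scaleC: "r *\<^sub>R x = complex_of_real r *\<^sub>C x"
    and mult_scaleC_left: "(c *\<^sub>C x) * y = c *\<^sub>C (x * y)"
    and mult_scaleC_right: "x * (c *\<^sub>C y) = c *\<^sub>C (x * y)"
    and norm_scaleC: "norm (c *\<^sub>C x) = cmod c * norm x"
    and star_add: "star (x + y) = star x + star y"
    and star_scaleC: "star (c *\<^sub>C x) = cnj c *\<^sub>C star x"
    and star_mult: "star (x * y) = star y * star x"
    and star_star: "star (star x) = x"
    and cstar_identity: "norm (star x * x) = (norm x)\<^sup>2"

definition is_projection :: "'a::unital_cstar_algebra \<Rightarrow> bool" where
  "is_projection p \<longleftrightarrow> star p = p \<and> p * p = p"

definition mvn_equiv :: "'a::unital_cstar_algebra \<Rightarrow> 'a \<Rightarrow> bool" where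
  "mvn_equiv p q \<longleftrightarrow> (\<exists>v. v * star v = p \<and> star v * v = q)"

definition invertible_up_to :: "'a::unital_cstar_algebra \<Rightarrow> 'a \<Rightarrow> 'a \<Rightarrow> bool" where
  "invertible_up_to a p q \<longleftrightarrow>
     (\<exists>b. (1 - q) * a * (1 - p) * b = 1 - q \<and> b * (1 - q) * a * (1 - p) = 1 - p)"

definition left_mult :: "'a::unital_cstar_algebra \<Rightarrow> 'a \<Rightarrow> 'a" where
  "left_mult a = (\<lambda>x. a * x)"

(* The norm of the Hilbert module given by this inner product is the norm of the algebra,
   by cstar_identity. *)
definition module_inner :: "'a::unital_cstar_algebra \<Rightarrow> 'a \<Rightarrow> 'a" where
  "module_inner x y = star x * y"

definition closed_submodule :: "'a::unital_cstar_algebra set \<Rightarrow> bool" where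
  "closed_submodule M \<longleftrightarrow> closed M \<and> 0 \<in> M \<and> (\<forall>x\<in>M. \<forall>y\<in>M. x + y \<in> M) \<and>
     (\<forall>c. \<forall>x\<in>M. c *\<^sub>C x \<in> M) \<and> (\<forall>x\<in>M. \<forall>a. x * a \<in> M)"

definition direct_decomp :: "'a::unital_cstar_algebra set \<Rightarrow> 'a set \<Rightarrow> bool" where
  "direct_decomp M N \<longleftrightarrow> closed_submodule M \<and> closed_submodule N \<and>
     M \<inter> N = {0} \<and> {x + y | x y. x \<in> M \<and> y \<in> N} = UNIV"

definition orth_compl :: "'a::unital_cstar_algebra set \<Rightarrow> 'a set" where
  "orth_compl N = {y. \<forall>x\<in>N. module_inner x y = 0}"

(* The orthogonal projection onto N, as the element of the algebra whose left multiplication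
   it is.  Such an element is unique if it exists, and it exists for complementable N; otherwise
   the value is unspecified. *)
definition orth_proj :: "'a::unital_cstar_algebra set \<Rightarrow> 'a" where
  "orth_proj N = (THE p. \<forall>x. left_mult p x \<in> N \<and> x - left_mult p x \<in> orth_compl N)"

(* Maps between submodules are functions on the whole algebra of which only the values on the
   domain M matter. *)
definition module_iso ::
    "'a::unital_cstar_algebra set \<Rightarrow> 'a set \<Rightarrow> ('a \<Rightarrow> 'a) \<Rightarrow> bool" where
  "module_iso M N f \<longleftrightarrow> (\<forall>x\<in>M. \<forall>y\<in>M. f (x + y) = f x + f y) \<and>
     (\<forall>c. \<forall>x\<in>M. f (c *\<^sub>C x) = c *\<^sub>C f x) \<and> (\<forall>x\<in>M. \<forall>a. f (x * a) = f x * a) \<and>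
     (\<exists>K. \<forall>x\<in>M. norm (f x) \<le> K * norm x) \<and> bij_betw f M N"

definition has_diag_matrix ::
    "('a::unital_cstar_algebra \<Rightarrow> 'a) \<Rightarrow> 'a set \<Rightarrow> 'a set \<Rightarrow> 'a set \<Rightarrow> 'a set \<Rightarrow>
     ('a \<Rightarrow> 'a) \<Rightarrow> ('a \<Rightarrow> 'a) \<Rightarrow> bool" where
  "has_diag_matrix f M1 N1 M2 N2 F1 F4 \<longleftrightarrow>
     f ` M1 \<subseteq> M2 \<and> f ` N1 \<subseteq> N2 \<and> F1 = restrict f M1 \<and> F4 = restrict f N1"

end

theory Submission imports Defs begin

text \<open>
  A decomposition of the algebra into closed submodules is given by an idempotent \<open>e\<close>, the component of
  \<open>1\<close>. The range of an idempotent \<open>f\<close> has the orthogonal projection \<open>f (1 + f - f\<^sup>*)\<^sup>-\<^sup>1\<close>, the inverse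
  existing because \<open>f - f\<^sup>*\<close> is skew-adjoint. In (1) one takes \<open>P\<close> and \<open>Q\<close> to be the orthogonal
  projections onto \<open>N1\<close> and \<open>N2\<close>, as \<open>F\<close> induces an isomorphism of the quotients by \<open>N1\<close> and \<open>N2\<close>.
  In (2), normalising \<open>b = (1 - P) b (1 - Q)\<close>, the idempotents \<open>b F\<close> and \<open>F b\<close> give the decompositions;
  there \<open>N2\<close> is the range of \<open>Q\<close>, while \<open>N1\<close> and the range of \<open>P\<close> have the common complement \<open>M1\<close>.
  If \<open>R\<close> projects onto \<open>N1\<close>, then \<open>T = P + R - 1\<close> is self-adjoint, invertible and satisfies
  \<open>T R = P T\<close>, so the symmetry \<open>T \<bar>T\<bar>\<^sup>-\<^sup>1\<close> intertwines \<open>P\<close> and \<open>R\<close>.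
\<close>

section \<open>The involution and the norm\<close>

lemma star_scaleR: "star (r *\<^sub>R x) = r *\<^sub>R star (x::'a::unital_cstar_algebra)"
  by (simp add: scaleR_eq_scaleC star_scaleC)

lemma star_minus: "star (- x) = - star (x::'a::unital_cstar_algebra)"
  using star_scaleR[of "- 1" x] by simp

lemma star_zero [simp]: "star (0::'a::unital_cstar_algebra) = 0"
  using star_scaleR[of 0 "0::'a"] by simp

lemma star_diff: "star (x - y) = star x - star (y::'a::unital_cstar_algebra)"
  using star_add[of x "- y"] by (simp add: star_minus)

lemma star_one [simp]: "star (1::'a::unital_cstar_algebra) = 1"
proof -
  have "star (star 1 * 1) = star (1::'a) * 1"
    by (simp only: star_mult star_star)
  then show ?thesis
    by (simp add: star_star)
qed

lemma norm_le_one_if_norm_square_le: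
  fixes x :: "'a::unital_cstar_algebra"
  assumes "norm (star x * x) \<le> norm x"
  shows "norm x \<le> 1"
proof (rule ccontr)
  assume "\<not> norm x \<le> 1"
  then have "norm x * 1 < norm x * norm x"
    by (intro mult_strict_left_mono) auto
  then show False
    using assms by (simp add: cstar_identity power2_eq_square)
qed

text \<open>The element \<open>1\<close> is its own \<open>star 1 * 1\<close>. Equality fails in the
  zero algebra.\<close>

lemma norm_one_le: "norm (1::'a::unital_cstar_algebra) \<le> 1"
  by (rule norm_le_one_if_norm_square_le) simp

lemma norm_le_norm_star: "norm x \<le> norm (star (x::'a::unital_cstar_algebra))"
proof (cases "norm x = 0")
  case False
  have "norm x * norm x \<le> norm (star x) * norm x"
    using norm_mult_ineq[of "star x" x] by (simp add: cstar_identity power2_eq_square)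
  then show ?thesis
    using False by simp
qed simp

lemma norm_star [simp]: "norm (star x) = norm (x::'a::unital_cstar_algebra)"
  using norm_le_norm_star[of x] norm_le_norm_star[of "star x"] by (simp add: star_star)

lemma continuous_star: "continuous_on A (star :: 'a::unital_cstar_algebra \<Rightarrow> 'a)"
proof -
  have "bounded_linear (star :: 'a \<Rightarrow> 'a)"
    by (rule bounded_linear_intro[where K = 1]) (simp_all add: star_add star_scaleR)
  then show ?thesis
    by (rule linear_continuous_on)
qed

section \<open>Inverses and square roots\<close>

text \<open>The contractions \<open>y \<mapsto> 1 + x * y\<close> and
  \<open>y \<mapsto> 1 + y * x\<close> have fixed points, which are a right and a left inverse and
  agree by associativity.\<close>

lemma one_minus_invertible:
  fixes x :: "'a::unital_cstar_algebra"
  assumes "norm x < 1"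
  obtains y where "(1 - x) * y = 1" "y * (1 - x) = 1"
proof -
  have "\<exists>!y. 1 + x * y = y"
  proof (rule banach_fix_type[where c = "norm x"])
    show "\<forall>y z. dist (1 + x * y) (1 + x * z) \<le> norm x * dist y z"
      using norm_mult_ineq[of x] by (simp add: dist_norm flip: right_diff_distrib)
  qed (use assms in auto)
  then obtain r where r: "1 + x * r = r"
    by auto
  have "\<exists>!y. 1 + y * x = y"
  proof (rule banach_fix_type[where c = "norm x"])
    have "dist (1 + y * x) (1 + z * x) \<le> norm x * dist y z" for y z
      using norm_mult_ineq[of "y - z" x]
      by (simp add: dist_norm left_diff_distrib mult.commute[of "norm x"])
    then show "\<forall>y z. dist (1 + y * x) (1 + z * x) \<le> norm x * dist y z"
      by blast
  qed (use assms in auto)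
  then obtain l where l: "1 + l * x = l"
    by auto
  have right: "(1 - x) * r = 1"
    using r by (simp add: left_diff_distrib) (metis add_diff_cancel_right')
  have left: "l * (1 - x) = 1"
    using l by (simp add: right_diff_distrib) (metis add_diff_cancel_right')
  have "l = r"
    using left right by (metis mult.assoc mult_1_left mult_1_right)
  then show thesis
    using that left right by simp
qed

text \<open>For large \<open>t\<close> the element \<open>t - k\<close> has norm less than \<open>1 + t\<close>, since the square of its norm is that
  of \<open>t\<^sup>2 - k\<^sup>2\<close>.\<close>

lemma one_plus_skew_adjoint_invertible:
  fixes k :: "'a::unital_cstar_algebra"
  assumes k: "star k = - k"
  obtains y where "(1 + k) * y = 1" "y * (1 + k) = 1"
proof -
  \<comment> \<open>This \<open>t\<close> bounds the squared norm of \<open>z\<close> by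
    \<open>t * t + t\<close>, which is below \<open>(1 + t)\<^sup>2\<close>.\<close>
  define t where "t = (norm k)\<^sup>2"
  have t: "t \<ge> 0"
    by (simp add: t_def)
  define z where "z = t *\<^sub>R 1 - k"
  have "star z * z = (t * t) *\<^sub>R 1 - k * k"
    by (simp add: z_def star_diff star_scaleR k algebra_simps)
  then have "(norm z)\<^sup>2 = norm ((t * t) *\<^sub>R 1 - k * k)"
    by (metis cstar_identity)
  also have "\<dots> \<le> norm ((t * t) *\<^sub>R (1::'a)) + norm (k * k)"
    by (rule norm_triangle_ineq4)
  also have "\<dots> \<le> t * t * norm (1::'a) + norm k * norm k"
    using t norm_mult_ineq[of k k] by simp
  also have "\<dots> \<le> t * t + t"
    using mult_left_mono[OF norm_one_le[where 'a='a], of "t * t"] t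
    by (simp add: t_def power2_eq_square)
  also have "\<dots> < (1 + t)\<^sup>2"
    using t by (simp add: power2_eq_square algebra_simps)
  finally have nz: "norm z < 1 + t"
    using t by (simp add: power2_less_imp_less)
  define x where "x = (1 / (1 + t)) *\<^sub>R z"
  have "norm x < 1"
    using nz t by (simp add: x_def)
  then obtain y where y: "(1 - x) * y = 1" "y * (1 - x) = 1"
    using one_minus_invertible by blast
  have "1 + k = (1 + t) *\<^sub>R 1 - z"
    by (simp add: z_def scaleR_add_left)
  also have "\<dots> = (1 + t) *\<^sub>R (1 - x)"
    using t by (simp add: x_def scaleR_diff_right)
  finally have eq: "1 + k = (1 + t) *\<^sub>R (1 - x)" .
  show thesis
    by (rule that[of "(1 / (1 + t)) *\<^sub>R y"]) (use t y in \<open>simp_all add: eq\<close>)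
qed

text \<open>The element \<open>1 - s\<close> is the fixed point of \<open>y \<mapsto> (x + y\<^sup>2) / 2\<close>, a contraction of the ball of
  radius \<open>norm x\<close>.\<close>

lemma sqrt_one_minus:
  fixes x :: "'a::unital_cstar_algebra"
  assumes nx: "norm x < 1" and sx: "star x = x"
  obtains s where "star s = s" "s * s = 1 - x" "\<And>z. z * x = x * z \<Longrightarrow> z * s = s * z"
proof -
  define r where "r = norm x"
  \<comment> \<open>Self-adjointness and commuting with everything that commutes with
    \<open>x\<close> are closed conditions; built into the complete set \<open>S\<close>, they pass
    to the fixed point.\<close>
  define S where "S = cball 0 r \<inter> {y. star y = y} \<inter> (\<Inter>z\<in>{z. z * x = x * z}. {y. z * y = y * z})"
  define f where "f = (\<lambda>y. (1/2) *\<^sub>R (x + y * y))"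
  have r: "0 \<le> r" "r < 1"
    using nx by (auto simp: r_def)
  have S: "norm y \<le> r" "star y = y" "\<And>z. z * x = x * z \<Longrightarrow> z * y = y * z" if "y \<in> S" for y
    using that unfolding S_def by (simp, blast+)
  have "closed S"
    unfolding S_def
    by (intro closed_Int closed_cball closed_INT closed_Collect_eq ballI continuous_intros continuous_star)
  then have "complete S"
    by (simp add: complete_eq_closed)
  moreover have "0 \<in> S"
    using r by (simp add: S_def)
  moreover have "f ` S \<subseteq> S"
  proof
    fix w assume "w \<in> f ` S"
    then obtain y where y: "y \<in> S" and w: "w = f y"
      by blast
    have "norm (y * y) \<le> r * r"
      using norm_mult_ineq[of y y] S(1)[OF y] r by (meson mult_mono norm_ge_zero order_trans)
    then have "norm (y * y) \<le> r"
      using r mult_left_le[of r r] by linarith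
    then have "norm (f y) \<le> r"
      using norm_triangle_ineq[of x "y * y"] by (simp add: f_def r_def)
    moreover have "star (f y) = f y"
      by (simp add: f_def star_scaleR star_add star_mult sx S(2)[OF y])
    moreover have "z * f y = f y * z" if "z * x = x * z" for z
    proof -
      have "z * y = y * z"
        by (rule S(3)[OF y that])
      then have "z * (y * y) = y * y * z"
        by (metis mult.assoc)
      then show ?thesis
        using that by (simp add: f_def distrib_left distrib_right)
    qed
    ultimately show "w \<in> S"
      unfolding S_def w by simp
  qed
  moreover have "dist (f y) (f z) \<le> r * dist y z" if "y \<in> S" "z \<in> S" for y z
  proof -
    \<comment> \<open>This splitting of \<open>y * y - z * z\<close> holds without commutativity and
      yields the contraction constant \<open>r\<close>.\<close>
    have "f y - f z = (1/2) *\<^sub>R (y * (y - z) + (y - z) * z)"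
      by (simp add: f_def algebra_simps flip: scaleR_diff_right)
    then have "norm (f y - f z) \<le> (1/2) * (norm (y * (y - z)) + norm ((y - z) * z))"
      by (simp add: norm_triangle_ineq)
    also have "\<dots> \<le> (1/2) * (r * norm (y - z) + norm (y - z) * r)"
    proof -
      have "norm (y * (y - z)) \<le> r * norm (y - z)"
        using norm_mult_ineq mult_right_mono[OF S(1)[OF that(1)] norm_ge_zero] by (rule order_trans)
      moreover have "norm ((y - z) * z) \<le> norm (y - z) * r"
        using norm_mult_ineq mult_left_mono[OF S(1)[OF that(2)] norm_ge_zero] by (rule order_trans)
      ultimately show ?thesis
        by (intro mult_left_mono add_mono) auto
    qed
    finally show ?thesis
      by (simp add: dist_norm mult.commute)
  qed
  ultimately have "\<exists>!y\<in>S. f y = y"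
    using r by (intro Banach_fix) auto
  then obtain y where y: "y \<in> S" "f y = y"
    by blast
  have "x + y * y = 2 *\<^sub>R f y"
    by (simp add: f_def)
  then have "x + y * y = y + y"
    by (simp add: y scaleR_2)
  then have "(1 - y) * (1 - y) = 1 - x"
    by (simp add: algebra_simps)
  moreover have "star (1 - y) = 1 - y"
    by (simp add: star_diff S(2)[OF y(1)])
  moreover have "z * (1 - y) = (1 - y) * z" if "z * x = x * z" for z
    using S(3)[OF y(1) that] by (simp add: algebra_simps)
  ultimately show thesis
    using that by blast
qed

text \<open>If \<open>s\<^sup>2 = 1 - t\<^sup>2\<close>, then \<open>t + \<i> s\<close> is unitary, so its imaginary part \<open>s\<close> is a contraction.\<close>

lemma norm_one_minus_square_le:
  fixes t :: "'a::unital_cstar_algebra"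
  assumes st: "star t = t" and nt: "norm (t * t) < 1"
  shows "norm (1 - t * t) \<le> 1"
proof -
  have "star (t * t) = t * t"
    by (simp add: star_mult st)
  then obtain s where s: "star s = s" "s * s = 1 - t * t"
      and comm: "\<And>z. z * (t * t) = t * t * z \<Longrightarrow> z * s = s * z"
    using sqrt_one_minus[OF nt] by metis
  have ts: "t * s = s * t"
    by (intro comm) (simp add: mult.assoc)
  define j where "j = \<i> *\<^sub>C s"
  have neg: "(- c) *\<^sub>C x = - (c *\<^sub>C x)" for c and x :: 'a
    using scaleC_add_left[of "- c" c x] scaleR_eq_scaleC[of 0 x] by (simp add: add_eq_0_iff2)
  have "star j = - j"
    by (simp add: j_def star_scaleC s neg)
  have jj: "j * j = - (s * s)"
    using scaleR_eq_scaleC[of 1 "s * s"]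
    by (simp add: j_def mult_scaleC_left mult_scaleC_right scaleC_scaleC neg)
  have tj: "t * j = j * t"
    by (simp add: j_def mult_scaleC_left mult_scaleC_right ts)
  have "star (t + j) * (t + j) = 1"
    by (simp add: star_add st \<open>star j = - j\<close> algebra_simps tj jj s)
  then have "(norm (t + j))\<^sup>2 \<le> 1"
    by (metis cstar_identity norm_one_le)
  then have u: "norm (t + j) \<le> 1"
    by (simp add: abs_square_le_1)
  \<comment> \<open>The skew-adjoint part of the contraction \<open>t + j\<close> is
    \<open>j\<close>, which has the norm of \<open>s\<close>.\<close>
  have "(t + j) - star (t + j) = 2 *\<^sub>R j"
    by (simp add: star_add st \<open>star j = - j\<close> scaleR_2)
  then have "2 * norm j \<le> norm (t + j) + norm (star (t + j))"
    by (metis abs_numeral norm_scaleR norm_triangle_ineq4)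
  then have "norm j \<le> 1"
    using u by simp
  then have "norm s \<le> 1"
    by (simp add: j_def norm_scaleC)
  then have "(norm s)\<^sup>2 \<le> 1"
    by (simp add: power_le_one)
  then show ?thesis
    by (metis cstar_identity s)
qed

text \<open>For small \<open>\<delta>\<close> the element \<open>t\<^sup>2 - \<delta>\<close> is again the square of a self-adjoint element, which makes the
  previous estimate strict: \<open>norm ((1 + \<delta>) - t\<^sup>2) \<le> 1 < 1 + \<delta>\<close>.\<close>

lemma self_adjoint_abs_small:
  fixes t g :: "'a::unital_cstar_algebra"
  assumes st: "star t = t" and inv: "t * g = 1" "g * t = 1" and nt: "norm (t * t) \<le> 1/2"
  obtains s where "star s = s" "s * s = t * t" "\<And>z. z * (t * t) = t * t * z \<Longrightarrow> z * s = s * z"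
proof -
  \<comment> \<open>This \<open>d\<close> makes \<open>d *\<^sub>R (g * g)\<close> a strict
    contraction, so that \<open>1\<close> minus it has a root \<open>r\<close>, and keeps
    \<open>1/2 + d\<close> below \<open>1\<close>. As \<open>g\<close> inverts \<open>t\<close>, the
    square of \<open>t * r\<close> is \<open>t * t - d *\<^sub>R 1\<close>.\<close>
  define d where "d = 1 / (4 * (1 + norm (g * g)))"
  have d: "0 < d" "d \<le> 1/4"
    by (auto simp: d_def field_simps add_pos_nonneg)
  have "star g = g"
    by (metis inv mult.assoc mult_1_left mult_1_right st star_mult star_one)
  then have sg: "star (d *\<^sub>R (g * g)) = d *\<^sub>R (g * g)"
    by (simp add: star_scaleR star_mult)
  have "norm (d *\<^sub>R (g * g)) < 1"
    using d by (simp add: d_def divide_simps add_nonneg_eq_0_iff) (smt (verit) norm_ge_zero)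
  then obtain r where r: "star r = r" "r * r = 1 - d *\<^sub>R (g * g)"
      and comm: "\<And>z. z * (d *\<^sub>R (g * g)) = d *\<^sub>R (g * g) * z \<Longrightarrow> z * r = r * z"
    using sqrt_one_minus sg by metis
  have tr: "t * r = r * t"
    using inv by (intro comm) (simp add: mult.assoc, simp flip: mult.assoc)
  have ttgg: "t * t * (g * g) = 1"
    by (metis inv(1) mult.assoc mult_1_left)
  have sq: "(t * r) * (t * r) = t * t - d *\<^sub>R 1"
  proof -
    have "(t * r) * (t * r) = t * t * (r * r)"
      by (metis tr mult.assoc)
    then show ?thesis
      by (simp add: r right_diff_distrib ttgg)
  qed
  have "norm (t * t - d *\<^sub>R 1) \<le> norm (t * t) + d * norm (1::'a)"
    using norm_triangle_ineq4[of "t * t" "d *\<^sub>R 1"] d by simp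
  also have "\<dots> \<le> 1/2 + d * 1"
    using nt d norm_one_le by (intro add_mono mult_left_mono) auto
  finally have "norm ((t * r) * (t * r)) < 1"
    using d sq by simp
  then have "norm (1 - (t * r) * (t * r)) \<le> 1"
    by (intro norm_one_minus_square_le) (simp_all add: star_mult st r tr)
  then have n1: "norm ((1 + d) *\<^sub>R 1 - t * t) \<le> 1"
    by (simp only: sq scaleR_add_left scaleR_one diff_diff_eq2 add.commute)
  \<comment> \<open>Since \<open>t * t = (1 + d) *\<^sub>R (1 - y)\<close>, a root of
    \<open>1 - y\<close> only has to be rescaled.\<close>
  define y where "y = 1 - (1 / (1 + d)) *\<^sub>R (t * t)"
  have "y = (1 / (1 + d)) *\<^sub>R ((1 + d) *\<^sub>R 1 - t * t)"
    using d by (simp add: y_def scaleR_diff_right)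
  then have "norm y < 1"
    using n1 d by simp
  moreover have "star y = y"
    by (simp add: y_def star_diff star_scaleR star_mult st)
  ultimately obtain s where s: "star s = s" "s * s = 1 - y"
      and scomm: "\<And>z. z * y = y * z \<Longrightarrow> z * s = s * z"
    using sqrt_one_minus by metis
  show thesis
  proof (rule that)
    show "star (sqrt (1 + d) *\<^sub>R s) = sqrt (1 + d) *\<^sub>R s"
      by (simp add: star_scaleR s)
    show "sqrt (1 + d) *\<^sub>R s * sqrt (1 + d) *\<^sub>R s = t * t"
      using d by (simp add: s y_def)
    show "z * sqrt (1 + d) *\<^sub>R s = sqrt (1 + d) *\<^sub>R s * z" if "z * (t * t) = t * t * z" for z
      using scomm[of z] that by (simp add: y_def algebra_simps)
  qed
qed

text \<open>Scaling \<open>t\<close> to norm at most \<open>1/2\<close> reduces this to the small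
  case. The element \<open>s\<close> serves as an absolute value of \<open>t\<close>.\<close>

lemma self_adjoint_abs:
  fixes t g :: "'a::unital_cstar_algebra"
  assumes st: "star t = t" and inv: "t * g = 1" "g * t = 1"
  obtains s where "star s = s" "s * s = t * t" "\<And>z. z * (t * t) = t * t * z \<Longrightarrow> z * s = s * z"
proof -
  define c where "c = 1 / (2 * (1 + norm t))"
  have c: "c > 0"
    by (simp add: c_def add_pos_nonneg)
  have "norm (c *\<^sub>R t) \<le> 1/2"
    by (simp add: c_def divide_simps add_nonneg_eq_0_iff) (smt (verit) norm_ge_zero)
  then have "norm (c *\<^sub>R t) * norm (c *\<^sub>R t) \<le> 1/2 * (1/2)"
    by (intro mult_mono) auto
  then have "norm (c *\<^sub>R t * c *\<^sub>R t) \<le> 1/2"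
    using norm_mult_ineq[of "c *\<^sub>R t" "c *\<^sub>R t"] by linarith
  moreover have "star (c *\<^sub>R t) = c *\<^sub>R t" "c *\<^sub>R t * (1 / c) *\<^sub>R g = 1" "(1 / c) *\<^sub>R g * c *\<^sub>R t = 1"
    using st inv c by (simp_all add: star_scaleR)
  ultimately obtain s where s: "star s = s" "s * s = c *\<^sub>R t * c *\<^sub>R t"
      and comm: "\<And>z. z * (c *\<^sub>R t * c *\<^sub>R t) = c *\<^sub>R t * c *\<^sub>R t * z \<Longrightarrow> z * s = s * z"
    using self_adjoint_abs_small by metis
  show thesis
  proof (rule that)
    show "star ((1 / c) *\<^sub>R s) = (1 / c) *\<^sub>R s"
      by (simp add: star_scaleR s)
    show "(1 / c) *\<^sub>R s * (1 / c) *\<^sub>R s = t * t"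
      using c by (simp add: s)
    show "z * (1 / c) *\<^sub>R s = (1 / c) *\<^sub>R s * z" if "z * (t * t) = t * t * z" for z
      using comm[of z] that by simp
  qed
qed

section \<open>Projections and idempotents\<close>

lemma mvn_equiv_refl: "is_projection p \<Longrightarrow> mvn_equiv p p"
  unfolding mvn_equiv_def is_projection_def by metis

text \<open>The hypotheses on \<open>f\<close> say that it is the idempotent with the kernel of \<open>p\<close> and the range of \<open>r\<close>.\<close>

lemma mvn_equiv_if_idempotent:
  fixes p r f :: "'a::unital_cstar_algebra"
  assumes p: "is_projection p" and r: "is_projection r"
    and pf: "p * f = p" "f * p = f" and rf: "f * r = r" "r * f = f"
  shows "mvn_equiv p r"
proof -
  \<comment> \<open>Both \<open>t * r\<close> and \<open>p * t\<close> equal \<open>p * r\<close>,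
    so \<open>t\<close> intertwines the projections; the idempotent \<open>f\<close> supplies the
    inverse \<open>g\<close>.\<close>
  define t where "t = p + r - 1"
  define g where "g = f + star f - 1"
  have sp: "star p = p" "p * p = p" and sr: "star r = r" "r * r = r"
    using p r by (auto simp: is_projection_def)
  have st: "star t = t"
    by (simp add: t_def star_add star_diff sp sr)
  have sf: "p * star f = star f" "r * star f = r"
    using pf(2) rf(1) by (metis star_mult sp(1), metis star_mult sr(1))
  have tg: "t * g = 1"
    by (simp add: t_def g_def algebra_simps pf rf sf)
  have sg: "star g = g"
    by (simp add: g_def star_add star_diff star_star)
  have gt: "g * t = 1"
    by (metis tg sg st star_mult star_one)
  obtain s where s: "star s = s" "s * s = t * t"
      and comm: "\<And>z. z * (t * t) = t * t * z \<Longrightarrow> z * s = s * z"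
    using self_adjoint_abs[OF st tg gt] by metis
  have ts: "t * s = s * t"
    by (intro comm) (simp add: mult.assoc)
  have gs: "g * s = s * g"
    by (metis ts tg gt mult.assoc mult_1_left mult_1_right)
  have tr: "t * r = p * t" "t * p = r * t"
    by (simp_all add: t_def algebra_simps sp sr)
  have rs: "r * s = s * r"
    by (intro comm) (metis tr mult.assoc)
  have gp: "g * p = r * g"
    by (metis tr(1) tg gt mult.assoc mult_1_left mult_1_right)
  \<comment> \<open>\<open>u = t s\<^sup>-\<^sup>1 = t\<^sup>-\<^sup>1 s\<close> because \<open>s\<^sup>2 = t\<^sup>2\<close>\<close>
  define u where "u = g * s"
  have su: "star u = u"
    by (simp add: u_def star_mult sg s gs)
  have uu: "u * u = 1"
  proof -
    have "u * u = g * g * (s * s)"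
      by (metis u_def gs mult.assoc)
    also have "\<dots> = 1"
      by (metis s(2) gt mult.assoc mult_1_left)
    finally show ?thesis .
  qed
  have pg: "p * g = g * r"
    by (metis gp sg sp(1) sr(1) star_mult)
  \<comment> \<open>The symmetry \<open>u\<close> carries \<open>r\<close> to \<open>p\<close>, so
    \<open>p * u\<close> is the required partial isometry.\<close>
  have pu: "p * u = u * r"
    by (metis u_def pg rs mult.assoc)
  have "(p * u) * star (p * u) = p"
    by (metis mult.assoc mult_1_left sp star_mult su uu)
  moreover have "star (p * u) * (p * u) = r"
  proof -
    have "star (p * u) * (p * u) = u * (p * u)"
      by (metis mult.assoc sp star_mult su)
    also have "\<dots> = r"
      by (metis pu mult.assoc mult_1_left uu)
    finally show ?thesis .
  qed
  ultimately show ?thesis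
    unfolding mvn_equiv_def by blast
qed

text \<open>An invertible right factor does not change the range of \<open>f\<close>; the factor
  \<open>w\<close> is the one that makes the product self-adjoint.\<close>

lemma range_projection:
  fixes f :: "'a::unital_cstar_algebra"
  assumes ff: "f * f = f"
  obtains r where "is_projection r" "f * r = r" "r * f = f"
proof -
  have sff: "star f * star f = star f"
    by (metis ff star_mult)
  have "star (f - star f) = - (f - star f)"
    by (simp add: star_diff star_star)
  then obtain w where w: "(1 + (f - star f)) * w = 1" "w * (1 + (f - star f)) = 1"
    using one_plus_skew_adjoint_invertible by blast
  have w': "star w * (1 - (f - star f)) = 1"
    using arg_cong[OF w(1), of star] by (simp add: star_mult star_add star_diff star_star algebra_simps)
  define r where "r = f * w"
  \<comment> \<open>Both sides are \<open>star f * f\<close>. Multiplied by \<open>star w\<close> on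
    the left and \<open>w\<close> on the right, this reads
    \<open>f * w = star w * star f\<close>.\<close>
  have eq: "(1 - (f - star f)) * f = star f * (1 + (f - star f))"
    by (simp add: algebra_simps ff sff)
  have sr: "star r = r"
  proof -
    have "f * w = star w * (1 - (f - star f)) * f * w"
      by (simp only: w' mult_1_left)
    also have "\<dots> = star w * ((1 - (f - star f)) * f) * w"
      by (simp only: mult.assoc)
    also have "\<dots> = star w * star f * ((1 + (f - star f)) * w)"
      by (simp only: eq mult.assoc)
    also have "\<dots> = star (f * w)"
      by (simp only: w(1) mult_1_right star_mult)
    finally show ?thesis
      by (simp only: r_def)
  qed
  have rf: "r * f = f"
  proof -
    have "r * f = star w * (star f * f)"
      by (metis sr r_def star_mult mult.assoc)
    also have "star f * f = (1 - (f - star f)) * f"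
      by (simp add: algebra_simps ff)
    finally show ?thesis
      by (metis w' mult.assoc mult_1_left)
  qed
  have fr: "f * r = r"
    by (metis r_def ff mult.assoc)
  have "r * r = r"
    by (metis r_def rf mult.assoc)
  then show thesis
    using that sr fr rf by (auto simp: is_projection_def)
qed

section \<open>Decompositions\<close>

text \<open>This serves both summands of a decomposition, as the range of an idempotent
  \<open>e\<close> is the kernel of \<open>1 - e\<close>.\<close>

lemma closed_submodule_kernel: "closed_submodule {x. a * x = (0::'a::unital_cstar_algebra)}"
  unfolding closed_submodule_def
proof (intro conjI)
  show "closed {x. a * x = 0}"
    by (intro closed_Collect_eq continuous_on_mult continuous_on_const continuous_on_id)
  have zero: "c *\<^sub>C (0::'a) = 0" for c
    using scaleC_add_right[of c "0::'a" 0] by simp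
  show "\<forall>c. \<forall>x\<in>{x. a * x = 0}. c *\<^sub>C x \<in> {x. a * x = 0}"
    by (simp add: mult_scaleC_right zero)
qed (simp_all add: distrib_left flip: mult.assoc)

lemma direct_decomp_idempotent:
  fixes e :: "'a::unital_cstar_algebra"
  assumes ee: "e * e = e"
  shows "direct_decomp {x. e * x = x} {x. e * x = 0}"
proof -
  have "{x. e * x = x} = {x. (1 - e) * x = 0}"
    by (auto simp: left_diff_distrib)
  then have "closed_submodule {x. e * x = x}" "closed_submodule {x. e * x = 0}"
    by (simp_all only: closed_submodule_kernel)
  moreover have "\<exists>y z. x = y + z \<and> e * y = y \<and> e * z = 0" for x
    by (rule exI[of _ "e * x"], rule exI[of _ "x - e * x"])
       (simp add: right_diff_distrib ee flip: mult.assoc)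
  ultimately show ?thesis
    by (auto simp: direct_decomp_def)
qed

text \<open>Multiplying \<open>1 = e + f\<close> on the right by \<open>x\<close> splits
  \<open>x\<close> into its components, because \<open>M\<close> and \<open>N\<close> are right
  submodules.\<close>

lemma direct_decomp_obtains_idempotent:
  fixes M N :: "'a::unital_cstar_algebra set"
  assumes "direct_decomp M N"
  obtains e where "e * e = e" "M = {x. e * x = x}" "N = {x. e * x = 0}"
proof -
  have addM: "x + y \<in> M" if "x \<in> M" "y \<in> M" for x y
    using assms that by (auto simp: direct_decomp_def closed_submodule_def)
  have addN: "x + y \<in> N" if "x \<in> N" "y \<in> N" for x y
    using assms that by (auto simp: direct_decomp_def closed_submodule_def)
  have mulM: "x * a \<in> M" if "x \<in> M" for x a
    using assms that by (auto simp: direct_decomp_def closed_submodule_def)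
  have mulN: "x * a \<in> N" if "x \<in> N" for x a
    using assms that by (auto simp: direct_decomp_def closed_submodule_def)
  have int: "M \<inter> N = {0}"
    using assms by (auto simp: direct_decomp_def)
  have "1 \<in> {x + y | x y. x \<in> M \<and> y \<in> N}"
    using assms by (auto simp: direct_decomp_def)
  then obtain e f where ef: "e \<in> M" "f \<in> N" "1 = e + f"
    by blast
  have split: "x = e * x + f * x" for x
    by (metis ef(3) distrib_right mult_1_left)
  have diffM: "x - y \<in> M" if "x \<in> M" "y \<in> M" for x y
    using addM[OF that(1) mulM[OF that(2), of "- 1"]] by simp
  have diffN: "x - y \<in> N" if "x \<in> N" "y \<in> N" for x y
    using addN[OF that(1) mulN[OF that(2), of "- 1"]] by simp
  have M: "f * x = 0" "e * x = x" if "x \<in> M" for x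
  proof -
    have "f * x = x - e * x"
      using split[of x] by (simp add: algebra_simps)
    then have "f * x \<in> M \<inter> N"
      by (metis IntI diffM that mulM mulN ef(1) ef(2))
    then show "f * x = 0"
      using int by auto
    then show "e * x = x"
      using split[of x] by simp
  qed
  have N: "e * x = 0" if "x \<in> N" for x
  proof -
    have "e * x = x - f * x"
      using split[of x] by (simp add: algebra_simps)
    then have "e * x \<in> M \<inter> N"
      by (metis IntI diffN that mulM mulN ef(1) ef(2))
    then show "e * x = 0"
      using int by auto
  qed
  show thesis
  proof (rule that)
    show "e * e = e"
      using M(2) ef(1) by blast
    show "M = {x. e * x = x}"
      using M(2) mulM[OF ef(1)] by (auto, metis)
    show "N = {x. e * x = 0}"
      using N mulN[OF ef(2)] split by (auto, metis add_0)
  qed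
qed

section \<open>Orthogonal projections onto submodules\<close>

lemma orth_proj_eqI:
  fixes r :: "'a::unital_cstar_algebra"
  assumes r: "is_projection r" and N: "N = {x. r * x = x}"
  shows "orth_proj N = r"
  unfolding orth_proj_def left_mult_def
proof (rule the_equality)
  have rr: "r * r = r" and sr: "star r = r"
    using r by (auto simp: is_projection_def)
  have "star y * (x - r * x) = 0" if "r * y = y" for x y
  proof -
    have "star y * r = star y"
      by (metis that sr star_mult)
    then show ?thesis
      by (simp add: right_diff_distrib flip: mult.assoc)
  qed
  then show "\<forall>x. r * x \<in> N \<and> x - r * x \<in> orth_compl N"
    by (auto simp: N orth_compl_def module_inner_def rr simp flip: mult.assoc)
  \<comment> \<open>For uniqueness the value at \<open>1\<close> suffices: \<open>p\<close> lies in
    \<open>N\<close>, and \<open>1 - p\<close> is orthogonal to \<open>r\<close>.\<close>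
  fix p assume p: "\<forall>x. p * x \<in> N \<and> x - p * x \<in> orth_compl N"
  have "r * p = p"
    using p[rule_format, of 1] by (simp add: N)
  moreover have "star r * (1 - p) = 0"
    using p[rule_format, of 1] by (simp add: N orth_compl_def module_inner_def rr)
  ultimately show "p = r"
    by (simp add: sr right_diff_distrib)
qed

text \<open>The kernel of \<open>e\<close> is the range of \<open>1 - e\<close>, and the last
  equation is \<open>r * (1 - e) = 1 - e\<close> rearranged.\<close>

lemma orth_proj_idempotent_kernel:
  fixes e :: "'a::unital_cstar_algebra"
  assumes "e * e = e"
  obtains r where "is_projection r" "orth_proj {x. e * x = 0} = r" "e * r = 0" "r * e = r + e - 1"
proof -
  have "(1 - e) * (1 - e) = 1 - e"
    by (simp add: algebra_simps assms)
  then obtain r where r: "is_projection r" "(1 - e) * r = r" "r * (1 - e) = 1 - e"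
    using range_projection by blast
  have er: "e * r = 0"
    using r(2) by (simp add: left_diff_distrib)
  have re: "r * e = r + e - 1"
    using r(3) by (simp add: right_diff_distrib algebra_simps)
  have "{x. e * x = 0} = {x. r * x = x}"
  proof (intro Collect_cong iffI)
    fix x assume "e * x = 0"
    then have "(1 - e) * x = x"
      by (simp add: left_diff_distrib)
    then show "r * x = x"
      by (metis r(3) mult.assoc)
  next
    fix x assume "r * x = x"
    then show "e * x = 0"
      by (metis er mult.assoc mult_zero_left)
  qed
  then have "orth_proj {x. e * x = 0} = r"
    by (rule orth_proj_eqI[OF r(1)])
  then show thesis
    using that r(1) er re by blast
qed

section \<open>Decompositions and invertibility up to a pair\<close>

text \<open>The elements \<open>1 - p\<close> and \<open>e1\<close> share the kernel
  \<open>N1\<close>, and \<open>1 - q\<close> and \<open>e2\<close> share \<open>N2\<close>, so the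
  isomorphism can be moved from \<open>M1\<close> and \<open>M2\<close> to the orthogonal
  complements.\<close>

lemma invertible_up_to_orth_proj:
  fixes F :: "'a::unital_cstar_algebra"
  assumes D1: "direct_decomp M1 N1" and D2: "direct_decomp M2 N2"
    and M: "has_diag_matrix (left_mult F) M1 N1 M2 N2 F1 F4" and iso: "module_iso M1 M2 F1"
  shows "is_projection (orth_proj N1)" "is_projection (orth_proj N2)"
    "invertible_up_to F (orth_proj N1) (orth_proj N2)"
proof -
  obtain e1 where e1: "e1 * e1 = e1" "M1 = {x. e1 * x = x}" "N1 = {x. e1 * x = 0}"
    using direct_decomp_obtains_idempotent[OF D1] .
  obtain e2 where e2: "e2 * e2 = e2" "M2 = {x. e2 * x = x}" "N2 = {x. e2 * x = 0}"
    using direct_decomp_obtains_idempotent[OF D2] .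
  obtain p where p: "is_projection p" "orth_proj N1 = p" "e1 * p = 0" "p * e1 = p + e1 - 1"
    using orth_proj_idempotent_kernel[OF e1(1)] e1(3) by metis
  obtain q where q: "is_projection q" "orth_proj N2 = q" "e2 * q = 0" "q * e2 = q + e2 - 1"
    using orth_proj_idempotent_kernel[OF e2(1)] e2(3) by metis
  show "is_projection (orth_proj N1)" "is_projection (orth_proj N2)"
    by (simp_all add: p q)
  have bij: "bij_betw (\<lambda>x. F * x) M1 M2"
    using iso M by (simp add: module_iso_def has_diag_matrix_def left_mult_def)
  have FN: "e2 * (F * x) = 0" if "e1 * x = 0" for x
    using M that by (auto simp: has_diag_matrix_def left_mult_def e1 e2)
  \<comment> \<open>A preimage \<open>g\<close> of \<open>e2\<close> in \<open>M1\<close> encodes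
    the inverse of \<open>F\<close> on \<open>M1\<close>: it is \<open>g * e2\<close>, extended by
    \<open>0\<close> on \<open>N2\<close>.\<close>
  have "e2 \<in> (\<lambda>x. F * x) ` M1"
    using bij e2 by (simp add: bij_betw_def)
  then obtain g where g: "e1 * g = g" "F * g = e2"
    by (auto simp: e1)
  have eF: "e2 * (F * e1) = F * e1"
    using bij e1 by (auto simp: bij_betw_def e2)
  have "e2 * (F * (1 - e1)) = 0"
    by (intro FN) (simp add: right_diff_distrib e1)
  then have e2F: "e2 * F = F * e1"
    by (simp add: right_diff_distrib eF)
  have "g * (F * e1) = e1"
  proof (rule inj_onD)
    show "inj_on (\<lambda>x. F * x) M1"
      using bij by (simp add: bij_betw_def)
    show "F * (g * (F * e1)) = F * e1"
      by (simp add: g eF flip: mult.assoc) (simp add: mult.assoc eF)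
    show "g * (F * e1) \<in> M1" "e1 \<in> M1"
      by (simp_all add: e1 g flip: mult.assoc)
  qed
  then have gF: "g * e2 * F = e1"
    by (simp add: mult.assoc e2F)
  have Fg: "F * (g * e2) = e2"
    by (simp add: g e2 flip: mult.assoc)
  have pe: "(1 - p) * e1 = 1 - p" and qe: "(1 - q) * e2 = 1 - q"
    by (simp_all add: left_diff_distrib p q)
  have pp: "(1 - p) * (1 - p) = 1 - p" and qq: "(1 - q) * (1 - q) = 1 - q"
    using p(1) q(1) by (simp_all add: is_projection_def algebra_simps)
  have ep: "e1 * (1 - p) = e1" and eq: "e2 * (1 - q) = e2"
    by (simp_all add: right_diff_distrib p q)
  define b where "b = (1 - p) * (g * e2)"
  have "(1 - q) * F * (1 - p) = (1 - q) * F"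
    by (metis qe e2F ep mult.assoc)
  then have "(1 - q) * F * (1 - p) * b = (1 - q) * (F * (g * e2))"
    by (metis b_def pp mult.assoc)
  then have "(1 - q) * F * (1 - p) * b = 1 - q"
    by (simp only: Fg qe)
  moreover have "b * (1 - q) * F * (1 - p) = 1 - p"
    by (metis b_def eq gF pe pp mult.assoc)
  ultimately show "invertible_up_to F (orth_proj N1) (orth_proj N2)"
    unfolding invertible_up_to_def p(2) q(2) by blast
qed

lemma decomposition_of_invertible_up_to:
  fixes F :: "'a::unital_cstar_algebra"
  assumes P: "is_projection P" and Q: "is_projection Q" and inv: "invertible_up_to F P Q"
  obtains M1 N1 M2 N2 where "direct_decomp M1 N1" "direct_decomp M2 N2"
    "has_diag_matrix (left_mult F) M1 N1 M2 N2 (restrict (left_mult F) M1) (restrict (left_mult F) N1)"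
    "module_iso M1 M2 (restrict (left_mult F) M1)"
    "mvn_equiv P (orth_proj N1)" "mvn_equiv Q (orth_proj N2)"
proof -
  obtain b0 where b0: "(1 - Q) * F * (1 - P) * b0 = 1 - Q" "b0 * (1 - Q) * F * (1 - P) = 1 - P"
    using inv by (auto simp: invertible_up_to_def)
  have PP: "(1 - P) * (1 - P) = 1 - P" and QQ: "(1 - Q) * (1 - Q) = 1 - Q"
    using P Q by (simp_all add: is_projection_def algebra_simps)
  \<comment> \<open>The compression preserves both equations and gives \<open>b * F * b = b\<close>,
    which makes \<open>b * F\<close> and \<open>F * b\<close> idempotent.\<close>
  define b where "b = (1 - P) * b0 * (1 - Q)"
  have b: "(1 - P) * b = b" "b * (1 - Q) = b"
    by (metis b_def PP mult.assoc, metis b_def QQ mult.assoc)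
  have bF: "b * F * (1 - P) = 1 - P"
    by (metis b_def b0(2) PP mult.assoc)
  have Fb: "(1 - Q) * (F * b) = 1 - Q"
    by (metis b_def b0(1) QQ mult.assoc)
  have bFb: "b * F * b = b"
    by (metis b(1) bF mult.assoc)
  define e1 where "e1 = b * F"
  define e2 where "e2 = F * b"
  have e1: "e1 * e1 = e1" and e2: "e2 * e2 = e2"
    unfolding e1_def e2_def by (metis bFb mult.assoc)+
  have Fe: "F * e1 = e2 * F"
    by (simp add: e1_def e2_def mult.assoc)
  let ?M1 = "{x. e1 * x = x}" and ?N1 = "{x. e1 * x = 0}"
  let ?M2 = "{x. e2 * x = x}" and ?N2 = "{x. e2 * x = 0}"
  have FM: "e2 * (F * x) = F * (e1 * x)" for x
    by (metis Fe mult.assoc)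
  obtain r where r: "is_projection r" "orth_proj ?N1 = r" "e1 * r = 0" "r * e1 = r + e1 - 1"
    using orth_proj_idempotent_kernel[OF e1] .
  have Pe: "P * e1 = 0" and eP: "e1 * P = e1 - 1 + P"
  proof -
    have "(1 - P) * e1 = e1"
      by (metis e1_def b(1) mult.assoc)
    then show "P * e1 = 0"
      by (simp add: left_diff_distrib)
    show "e1 * P = e1 - 1 + P"
      using bF by (simp add: e1_def right_diff_distrib algebra_simps)
  qed
  \<comment> \<open>The range \<open>M1\<close> of \<open>e1\<close> is that of
    \<open>1 - P\<close>, so \<open>1 - e1\<close> is the idempotent with the kernel of
    \<open>P\<close> and the range of \<open>r\<close>.\<close>
  have mvnP: "mvn_equiv P (orth_proj ?N1)"
    unfolding r(2)
    by (rule mvn_equiv_if_idempotent[where f = "1 - e1"])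
       (simp_all add: P r Pe eP right_diff_distrib left_diff_distrib)
  \<comment> \<open>As \<open>e2\<close> and \<open>1 - Q\<close> have the same kernel, the
    projection onto \<open>N2\<close> is \<open>Q\<close> itself.\<close>
  have "e2 * Q = 0"
    using b(2) by (simp add: e2_def right_diff_distrib mult.assoc)
  have "?N2 = {x. Q * x = x}"
  proof (intro Collect_cong iffI)
    fix x assume "e2 * x = 0"
    then have "(1 - Q) * x = 0"
      by (metis Fb e2_def mult.assoc mult_zero_right)
    then show "Q * x = x"
      by (simp add: left_diff_distrib)
  next
    fix x assume "Q * x = x"
    then show "e2 * x = 0"
      by (metis \<open>e2 * Q = 0\<close> mult.assoc mult_zero_left)
  qed
  then have mvnQ: "mvn_equiv Q (orth_proj ?N2)"
    using orth_proj_eqI[OF Q] mvn_equiv_refl[OF Q] by simp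
  have bij: "bij_betw (restrict (left_mult F) ?M1) ?M1 ?M2"
  proof (rule bij_betw_byWitness[where f' = "\<lambda>y. b * y"])
    show "\<forall>x\<in>?M1. b * restrict (left_mult F) ?M1 x = x"
      by (simp add: left_mult_def) (simp add: e1_def mult.assoc)
    show "restrict (left_mult F) ?M1 ` ?M1 \<subseteq> ?M2"
      by (auto simp: left_mult_def FM)
    have "b * y \<in> ?M1" "F * (b * y) = y" if "y \<in> ?M2" for y
      using that by (simp_all add: e1_def e2_def mult.assoc)
    then show "(\<lambda>y. b * y) ` ?M2 \<subseteq> ?M1" "\<forall>y\<in>?M2. restrict (left_mult F) ?M1 (b * y) = y"
      by (auto simp: left_mult_def)
  qed
  have sub: "closed_submodule ?M1"
    using direct_decomp_idempotent[OF e1] by (simp add: direct_decomp_def)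
  have iso: "module_iso ?M1 ?M2 (restrict (left_mult F) ?M1)"
    unfolding module_iso_def
  proof (intro conjI bij)
    show "\<exists>K. \<forall>x\<in>?M1. norm (restrict (left_mult F) ?M1 x) \<le> K * norm x"
      by (rule exI[of _ "norm F"]) (simp add: left_mult_def norm_mult_ineq)
  qed (use sub in \<open>simp_all add: closed_submodule_def left_mult_def distrib_left mult_scaleC_right mult.assoc\<close>)
  have diag: "has_diag_matrix (left_mult F) ?M1 ?N1 ?M2 ?N2
      (restrict (left_mult F) ?M1) (restrict (left_mult F) ?N1)"
    by (simp add: has_diag_matrix_def left_mult_def image_subset_iff FM)
  show thesis
    by (rule that[OF direct_decomp_idempotent[OF e1] direct_decomp_idempotent[OF e2] diag iso mvnP mvnQ])
qed

theorem lemma2p7: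
  fixes F :: "'a::unital_cstar_algebra"
  shows "(\<forall>M1 N1 M2 N2 F1 F4.
            direct_decomp M1 N1 \<and> direct_decomp M2 N2 \<and>
            has_diag_matrix (left_mult F) M1 N1 M2 N2 F1 F4 \<and> module_iso M1 M2 F1 \<longrightarrow>
            (\<exists>P Q. is_projection P \<and> is_projection Q \<and>
               mvn_equiv P (orth_proj N1) \<and> mvn_equiv Q (orth_proj N2) \<and>
               invertible_up_to F P Q)) \<and>
         (\<forall>P Q. is_projection P \<and> is_projection Q \<and> invertible_up_to F P Q \<longrightarrow>
            (\<exists>M1 N1 M2 N2 F1 F4.
               direct_decomp M1 N1 \<and> direct_decomp M2 N2 \<and>
               has_diag_matrix (left_mult F) M1 N1 M2 N2 F1 F4 \<and> module_iso M1 M2 F1 \<and>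
               mvn_equiv P (orth_proj N1) \<and> mvn_equiv Q (orth_proj N2)))"
  by (meson invertible_up_to_orth_proj mvn_equiv_refl decomposition_of_invertible_up_to)

end
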